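(* Let $\sigma$ be a labeled rooted forest that is a disjoint union $\sigma=\tau\cup\nu$ of two rooted forests $\tau$ and $\nu$ on $m$ and $k$ vertices, respectively. If $\tau$ and $\nu$ do not have any identical connected component (i.e. no connected component of $\tau$ is isomorphic, as an unlabeled rooted tree, to a connected component of $\nu$), then $$\chi^{o(\sigma)}=\chi^{o(\tau)}\cdot\chi^{o(\nu)}.$$
   Context: The symmetric group $S_n$ acts on labeled rooted forests with $n$ vertices labeled by $[n]=\{1,\dots,n\}$ by permuting labels. For such a forest $\sigma$, $o(\sigma)$ is the permutation representation of $S_n$ on the orbit $S_n\cdot\sigma$, and $\chi^{o(\sigma)}$ is its character; up to isomorphism it depends only on the underlying unlabeled rooted forest, so $o(\tau)$ and $o(\nu)$ are representations of $S_m$ and $S_k$ defined by relabeling $\tau$ by $[m]$ and $\nu$ by $[k]$. The product of a character $\chi$ of $S_m$ and a character $\psi$ of $S_k$ is the induction product $\chi\cdot\psi=\mathrm{Ind}_{S_m\times S_k}^{S_{m+k}}(\chi\otimes\psi)$. *)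

theory Defs
  imports
    "HOL.Complex"
    "HOL-Algebra.Group_Action"
    "HOL-Algebra.Sym_Groups"
begin

section \<open>Rooted forests\<close>

record 'a rooted_graph =
  verts :: "'a set"
  edges :: "'a set set"
  roots :: "'a set"

definition rooted_graph :: "'a rooted_graph \<Rightarrow> bool" where
  "rooted_graph G \<longleftrightarrow> finite (verts G) \<and>
     (\<forall>e\<in>edges G. e \<subseteq> verts G \<and> card e = 2) \<and> roots G \<subseteq> verts G"

definition adjacency :: "'a rooted_graph \<Rightarrow> ('a \<times> 'a) set" where
  "adjacency G = {(u, v). {u, v} \<in> edges G}"

definition connected_graph :: "'a rooted_graph \<Rightarrow> bool" where
  "connected_graph G \<longleftrightarrow> verts G \<noteq> {} \<and>
     (\<forall>u\<in>verts G. \<forall>v\<in>verts G. (u, v) \<in> (adjacency G)\<^sup>*)"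

definition is_cycle :: "'a rooted_graph \<Rightarrow> 'a list \<Rightarrow> bool" where
  "is_cycle G c \<longleftrightarrow> 3 \<le> length c \<and> distinct c \<and>
     (\<forall>i<length c. {c ! i, c ! (Suc i mod length c)} \<in> edges G)"

definition rooted_tree :: "'a rooted_graph \<Rightarrow> bool" where
  "rooted_tree T \<longleftrightarrow> rooted_graph T \<and> connected_graph T \<and>
     \<not> (\<exists>c. is_cycle T c) \<and> (\<exists>r. roots T = {r})"

definition induced_subgraph :: "'a rooted_graph \<Rightarrow> 'a set \<Rightarrow> 'a rooted_graph" where
  "induced_subgraph G S =
     \<lparr>verts = S, edges = {e \<in> edges G. e \<subseteq> S}, roots = roots G \<inter> S\<rparr>"

definition components :: "'a rooted_graph \<Rightarrow> 'a rooted_graph set" where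
  "components G =
     (\<lambda>v. induced_subgraph G {w \<in> verts G. (v, w) \<in> (adjacency G)\<^sup>*}) ` verts G"

text \<open>The empty forest is allowed.\<close>

definition rooted_forest :: "'a rooted_graph \<Rightarrow> bool" where
  "rooted_forest G \<longleftrightarrow> rooted_graph G \<and> (\<forall>C\<in>components G. rooted_tree C)"

definition labeled_rooted_forest :: "nat \<Rightarrow> nat rooted_graph \<Rightarrow> bool" where
  "labeled_rooted_forest n \<sigma> \<longleftrightarrow> rooted_forest \<sigma> \<and> verts \<sigma> = {1..n}"

definition is_disjoint_union ::
    "'a rooted_graph \<Rightarrow> 'a rooted_graph \<Rightarrow> 'a rooted_graph \<Rightarrow> bool" where
  "is_disjoint_union \<sigma> \<tau> \<nu> \<longleftrightarrow> verts \<tau> \<inter> verts \<nu> = {} \<and>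
     \<sigma> = \<lparr>verts = verts \<tau> \<union> verts \<nu>, edges = edges \<tau> \<union> edges \<nu>, roots = roots \<tau> \<union> roots \<nu>\<rparr>"

definition relabel :: "('a \<Rightarrow> 'b) \<Rightarrow> 'a rooted_graph \<Rightarrow> 'b rooted_graph" where
  "relabel f G = \<lparr>verts = f ` verts G, edges = (`) f ` edges G, roots = f ` roots G\<rparr>"

definition rooted_isomorphic :: "'a rooted_graph \<Rightarrow> 'b rooted_graph \<Rightarrow> bool" where
  "rooted_isomorphic G H \<longleftrightarrow> (\<exists>f. bij_betw f (verts G) (verts H) \<and> relabel f G = H)"


section \<open>Permutation representations\<close>

text \<open>The matrix, in the basis \<open>X\<close> of the free complex vector space on \<open>X\<close>, of the
  linear map permuting the basis according to the action \<open>\<phi>\<close>, and its trace.\<close>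

definition perm_rep :: "('g \<Rightarrow> 'x \<Rightarrow> 'x) \<Rightarrow> 'g \<Rightarrow> 'x \<Rightarrow> 'x \<Rightarrow> complex" where
  "perm_rep \<phi> g x y = (if \<phi> g y = x then 1 else 0)"

definition perm_character :: "('g \<Rightarrow> 'x \<Rightarrow> 'x) \<Rightarrow> 'x set \<Rightarrow> 'g \<Rightarrow> complex" where
  "perm_character \<phi> X g = (\<Sum>x\<in>X. perm_rep \<phi> g x x)"

definition orbit_character :: "nat \<Rightarrow> nat rooted_graph \<Rightarrow> (nat \<Rightarrow> nat) \<Rightarrow> complex" where
  "orbit_character n \<sigma> = perm_character relabel (orbit (sym_group n) relabel \<sigma>)"


section \<open>Induction product\<close>

text \<open>Induction of a class function along an injective homomorphism \<open>\<iota>\<close> from \<open>K\<close> to \<open>G\<close>,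
  by which \<open>K\<close> is regarded as a subgroup of \<open>G\<close>; the lemma \<open>induced_eq\<close> below gives the usual
  form of the formula.\<close>

definition induced ::
    "('g, 'c) monoid_scheme \<Rightarrow> ('k, 'd) monoid_scheme \<Rightarrow> ('k \<Rightarrow> 'g) \<Rightarrow> ('k \<Rightarrow> complex) \<Rightarrow> 'g \<Rightarrow> complex"
  where
  "induced G K \<iota> \<phi> x =
     (\<Sum>g\<in>carrier G. \<Sum>h | h \<in> carrier K \<and> \<iota> h = inv\<^bsub>G\<^esub> g \<otimes>\<^bsub>G\<^esub> x \<otimes>\<^bsub>G\<^esub> g. \<phi> h) / of_nat (order K)"

lemma induced_eq:
  assumes "\<iota> \<in> mon K G"
  shows "induced G K \<iota> \<phi> x =
    (\<Sum>g\<in>carrier G. let y = inv\<^bsub>G\<^esub> g \<otimes>\<^bsub>G\<^esub> x \<otimes>\<^bsub>G\<^esub> g in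
       if y \<in> \<iota> ` carrier K then \<phi> (inv_into (carrier K) \<iota> y) else 0) / of_nat (card (\<iota> ` carrier K))"
proof -
  have inj: "inj_on \<iota> (carrier K)"
    using assms by (simp add: mon_def)
  have *: "(\<Sum>h | h \<in> carrier K \<and> \<iota> h = y. \<phi> h) =
      (if y \<in> \<iota> ` carrier K then \<phi> (inv_into (carrier K) \<iota> y) else 0)" for y
  proof (cases "y \<in> \<iota> ` carrier K")
    case True
    then obtain h where h: "h \<in> carrier K" "y = \<iota> h" by blast
    then have "{h'. h' \<in> carrier K \<and> \<iota> h' = y} = {h}"
      using inj by (auto dest: inj_onD)
    then show ?thesis
      using h inj by (simp add: inv_into_f_f)
  next
    case False
    then have "{h'. h' \<in> carrier K \<and> \<iota> h' = y} = {}" by blast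
    then show ?thesis using False by (simp only: sum.empty if_False)
  qed
  show ?thesis
    unfolding induced_def * Let_def order_def card_image[OF inj] ..
qed

text \<open>The first factor acts on \<open>{1..m}\<close> and the second, shifted by \<open>m\<close>, on \<open>{m+1..m+k}\<close>.\<close>

definition young_embed :: "nat \<Rightarrow> (nat \<Rightarrow> nat) \<times> (nat \<Rightarrow> nat) \<Rightarrow> nat \<Rightarrow> nat" where
  "young_embed m = (\<lambda>(\<alpha>, \<beta>) i. if i \<le> m then \<alpha> i else m + \<beta> (i - m))"

lemma young_embed_mon:
  "young_embed m \<in> mon (sym_group m \<times>\<times> sym_group k) (sym_group (m + k))"
proof -
  have le: "p i \<le> n \<longleftrightarrow> i \<le> n" if "p permutes {1..n}" for p :: "nat \<Rightarrow> nat" and i n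
    using permutes_in_image[OF that, of i] permutes_not_in[OF that, of i]
    by (cases "i \<in> {1..n}") auto
  have pos: "p i = 0 \<longleftrightarrow> i = 0" if "p permutes {1..n}" for p :: "nat \<Rightarrow> nat" and i n
    using permutes_in_image[OF that, of i] permutes_not_in[OF that, of i]
    by (cases "i \<in> {1..n}") auto
  have comp: "young_embed m (a \<circ> a', b \<circ> b') = young_embed m (a, b) \<circ> young_embed m (a', b')"
    if "a' permutes {1..m}" "b' permutes {1..k}" for a a' b b'
    using le[OF that(1)] pos[OF that(2)] by (auto simp: young_embed_def fun_eq_iff)
  have id: "young_embed m (id, id) = id"
    by (auto simp: young_embed_def fun_eq_iff)
  have perm: "young_embed m (a, b) permutes {1..m + k}"
    if a: "a permutes {1..m}" and b: "b permutes {1..k}" for a b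
  proof -
    have "young_embed m (a, b) \<circ> young_embed m (inv' a, inv' b) = id"
      using comp[OF permutes_inv[OF a] permutes_inv[OF b], of a b]
      by (simp add: permutes_inv_o[OF a] permutes_inv_o[OF b] id)
    moreover have "young_embed m (inv' a, inv' b) \<circ> young_embed m (a, b) = id"
      using comp[OF a b, of "inv' a" "inv' b"]
      by (simp add: permutes_inv_o[OF a] permutes_inv_o[OF b] id)
    ultimately have "bij (young_embed m (a, b))"
      using o_bij by blast
    moreover have "young_embed m (a, b) i = i" if "i \<notin> {1..m + k}" for i
    proof -
      have "i - m \<notin> {1..k}"
        using that by auto
      then show ?thesis
        using that permutes_not_in[OF a, of i] permutes_not_in[OF b, of "i - m"]
        by (auto simp: young_embed_def)
    qed
    ultimately show ?thesis
      unfolding permutes_def bij_iff by blast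
  qed
  have inj: "inj_on (young_embed m) (carrier (sym_group m \<times>\<times> sym_group k))"
  proof -
    have "a = a' \<and> b = b'"
      if p: "a permutes {1..m}" "b permutes {1..k}" "a' permutes {1..m}" "b' permutes {1..k}"
        and eq: "young_embed m (a, b) = young_embed m (a', b')" for a b a' b'
    proof -
      have "a i = a' i" for i
        using fun_cong[OF eq, of i] permutes_not_in[OF p(1), of i] permutes_not_in[OF p(3), of i]
        by (cases "i \<le> m") (auto simp: young_embed_def)
      moreover have "b i = b' i" for i
        using fun_cong[OF eq, of "i + m"] permutes_not_in[OF p(2), of i] permutes_not_in[OF p(4), of i]
        by (cases "i = 0") (auto simp: young_embed_def)
      ultimately show ?thesis by auto
    qed
    then show ?thesis
      unfolding inj_on_def by (auto simp: sym_group_carrier)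
  qed
  show ?thesis
    using inj perm comp by (auto simp: mon_def hom_def sym_group_def)
qed

definition induction_product ::
    "nat \<Rightarrow> nat \<Rightarrow> ((nat \<Rightarrow> nat) \<Rightarrow> complex) \<Rightarrow> ((nat \<Rightarrow> nat) \<Rightarrow> complex) \<Rightarrow> (nat \<Rightarrow> nat) \<Rightarrow> complex"
  where
  "induction_product m k \<chi> \<psi> =
     induced (sym_group (m + k)) (sym_group m \<times>\<times> sym_group k) (young_embed m)
       (\<lambda>(\<alpha>, \<beta>). \<chi> \<alpha> * \<psi> \<beta>)"

end

theory Submission
  imports Defs
begin

text \<open>
  A permutation character is induced from the trivial character of a point stabilizer. So, if the
  stabilizer of \<open>x\<close> in \<open>G\<close> is the image under an embedding \<open>K \<rightarrow> G\<close> of the stabilizer of \<open>y\<close> in \<open>K\<close>,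
  transitivity of induction shows that the character of the orbit of \<open>x\<close> is induced from that
  of the orbit of \<open>y\<close>. This is applied with \<open>K = S\<^sub>m \<times> S\<^sub>k\<close> acting on pairs of forests: a
  permutation that fixes \<open>\<tau> \<union> \<nu>\<close> maps each component to an isomorphic component, so, there being no
  common component, it preserves the vertex sets of \<open>\<tau>\<close> and \<open>\<nu>\<close> and fixes both forests.
\<close>

section \<open>Permutation characters and induction\<close>

text \<open>On a whole type the extensionality condition hidden in \<open>Bij\<close> is vacuous,
  and bijectivity of \<open>\<phi> g\<close> comes from the two-sided inverse
  \<open>\<phi> (inv g)\<close>.\<close>

lemma group_action_UNIV:
  assumes "group G" and "\<phi> \<one>\<^bsub>G\<^esub> = id"
    and mult: "\<And>g h. g \<in> carrier G \<Longrightarrow> h \<in> carrier G \<Longrightarrow> \<phi> (g \<otimes>\<^bsub>G\<^esub> h) = \<phi> g \<circ> \<phi> h"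
  shows "group_action G UNIV \<phi>"
proof -
  interpret group G by fact
  have "bij (\<phi> g)" if g: "g \<in> carrier G" for g
    using mult[OF g inv_closed[OF g]] mult[OF inv_closed[OF g] g] g assms(2)
    by (metis l_inv r_inv o_bij)
  then have "\<phi> \<in> hom G (BijGroup UNIV)"
    using mult by (auto simp: hom_def BijGroup_def Bij_def compose_def fun_eq_iff)
  then show ?thesis
    by (simp add: group_action_def group_hom_def group_hom_axioms_def group_BijGroup \<open>group G\<close>)
qed

text \<open>The fibre over \<open>z = \<phi> a x\<close> is the left coset of the stabilizer by
  \<open>a\<close>.\<close>

lemma (in group_action) card_orbit_fibre:
  assumes "x \<in> E" and "z \<in> orbit G \<phi> x"
  shows "card {g \<in> carrier G. \<phi> g x = z} = card (stabilizer G \<phi> x)"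
proof -
  interpret group G using group_hom group_hom.axioms(1) by auto
  obtain a where a: "a \<in> carrier G" "\<phi> a x = z"
    using assms(2) by (auto simp: orbit_def)
  have "bij_betw (\<lambda>g. a \<otimes> g) (stabilizer G \<phi> x) {g \<in> carrier G. \<phi> g x = z}"
  proof (rule bij_betw_byWitness[where f' = "\<lambda>g. inv a \<otimes> g"])
    show "(\<lambda>g. a \<otimes> g) ` stabilizer G \<phi> x \<subseteq> {g \<in> carrier G. \<phi> g x = z}"
      using a assms(1) by (auto simp: stabilizer_def composition_rule)
    show "(\<lambda>g. inv a \<otimes> g) ` {g \<in> carrier G. \<phi> g x = z} \<subseteq> stabilizer G \<phi> x"
      using a assms(1) orbit_sym_aux[OF a(1) assms(1) a(2)]
      by (auto simp: stabilizer_def composition_rule)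
  qed (use a in \<open>auto simp: stabilizer_def m_assoc[symmetric]\<close>)
  then show ?thesis by (simp add: bij_betw_same_card)
qed

text \<open>The formula for inducing the trivial character from the stabilizer, with the denominator
  cleared. The element \<open>p\<close> fixes \<open>\<phi> g x\<close> exactly when its conjugate
  by \<open>g\<close> stabilizes \<open>x\<close>, and as \<open>g\<close> varies each orbit point
  is reached once for every element of the stabilizer.\<close>

lemma (in group_action) perm_character_orbit:
  assumes fin: "finite (carrier G)" and x: "x \<in> E" and p: "p \<in> carrier G"
  shows "perm_character \<phi> (orbit G \<phi> x) p * of_nat (card (stabilizer G \<phi> x)) =
    (\<Sum>g\<in>carrier G. of_bool (inv g \<otimes> p \<otimes> g \<in> stabilizer G \<phi> x))"
proof -
  interpret group G using group_hom group_hom.axioms(1) by auto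
  let ?O = "orbit G \<phi> x"
  have O: "?O = (\<lambda>g. \<phi> g x) ` carrier G" by (auto simp: orbit_def)
  have fixed: "\<phi> p (\<phi> g x) = \<phi> g x \<longleftrightarrow> inv g \<otimes> p \<otimes> g \<in> stabilizer G \<phi> x"
    if g: "g \<in> carrier G" for g
  proof -
    have gx: "\<phi> g x \<in> E" using element_image[OF g x] by simp
    have pgx: "\<phi> p (\<phi> g x) \<in> E" using element_image[OF p gx] by simp
    have "\<phi> (inv g \<otimes> p \<otimes> g) x = \<phi> (inv g) (\<phi> p (\<phi> g x))"
      using g p x gx by (simp add: composition_rule m_assoc)
    moreover have "\<phi> (inv g) (\<phi> g x) = x"
      using orbit_sym_aux[OF g x] by simp
    ultimately show ?thesis
      \<comment> \<open>The injective map \<open>\<phi> (inv g)\<close> sends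
        \<open>\<phi> g x\<close> to \<open>x\<close>, so the equation may be tested after applying
        it.\<close>
      using g p inj_onD[OF inj_prop[OF inv_closed[OF g]] _ pgx gx]
      by (auto simp: stabilizer_def)
  qed
  have "(\<Sum>g\<in>carrier G. of_bool (inv g \<otimes> p \<otimes> g \<in> stabilizer G \<phi> x)) =
      (\<Sum>g\<in>carrier G. perm_rep \<phi> p (\<phi> g x) (\<phi> g x))"
    by (rule sum.cong) (simp_all add: perm_rep_def fixed)
  also have "\<dots> = (\<Sum>z\<in>?O. \<Sum>g\<in>{g \<in> carrier G. \<phi> g x = z}. perm_rep \<phi> p (\<phi> g x) (\<phi> g x))"
    unfolding O by (rule sum.image_gen[OF fin])
  also have "\<dots> = (\<Sum>z\<in>?O. \<Sum>g\<in>{g \<in> carrier G. \<phi> g x = z}. perm_rep \<phi> p z z)"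
    by (intro sum.cong) auto
  also have "\<dots> = (\<Sum>z\<in>?O. perm_rep \<phi> p z z * of_nat (card (stabilizer G \<phi> x)))"
    using card_orbit_fibre[OF x] by (intro sum.cong) (auto simp: mult.commute)
  finally show ?thesis by (simp add: perm_character_def sum_distrib_right)
qed

text \<open>Transitivity of induction for trivial characters, by direct counting: after
  multiplication by the common order of the two stabilizers, both sides become the number
  \<open>N\<close> of those \<open>g\<close> whose conjugate of \<open>p\<close> lies in
  \<open>S\<close>.\<close>

lemma perm_character_orbit_induced:
  assumes G: "group_action G E \<phi>" "finite (carrier G)" "x \<in> E"
    and K: "group_action K F \<psi>" "finite (carrier K)" "y \<in> F"
    and \<iota>: "\<iota> \<in> mon K G"
    and stab: "stabilizer G \<phi> x = \<iota> ` stabilizer K \<psi> y"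
    and p: "p \<in> carrier G"
  shows "perm_character \<phi> (orbit G \<phi> x) p =
    induced G K \<iota> (perm_character \<psi> (orbit K \<psi> y)) p"
proof -
  interpret G: group_action G E \<phi> by fact
  interpret K: group_action K F \<psi> by fact
  interpret G: group G using G.group_hom group_hom.axioms(1) by auto
  interpret K: group K using K.group_hom group_hom.axioms(1) by auto
  interpret \<iota>: group_hom K G \<iota>
    using \<iota> by unfold_locales (auto simp: mon_def)
  define S where "S = stabilizer G \<phi> x"
  define T where "T = stabilizer K \<psi> y"
  have T: "T \<subseteq> carrier K" by (auto simp: T_def stabilizer_def)
  have inj: "inj_on \<iota> (carrier K)" using \<iota> by (simp add: mon_def)
  have ST: "S = \<iota> ` T" using stab by (simp add: S_def T_def)
  have "card S = card T"
    unfolding ST using inj_on_subset[OF inj T] by (rule card_image)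
  moreover have "finite T" using T K(2) finite_subset by blast
  \<comment> \<open>A nonempty \<open>T\<close> makes \<open>card T\<close> nonzero, so that it can
    be cancelled at the end.\<close>
  moreover have "\<one>\<^bsub>K\<^esub> \<in> T"
    using K.id_eq_one K(3) by (simp add: T_def stabilizer_def fun_eq_iff) (metis restrict_apply')
  ultimately have cT: "card T \<noteq> 0" "card S = card T" by auto
  have oK: "order K \<noteq> 0" using K(2) K.order_gt_0_iff_finite by simp
  define N :: complex
    where "N = (\<Sum>g\<in>carrier G. of_bool (inv\<^bsub>G\<^esub> g \<otimes>\<^bsub>G\<^esub> p \<otimes>\<^bsub>G\<^esub> g \<in> S))"
  \<comment> \<open>Injectivity of \<open>\<iota>\<close> leaves at most one \<open>h\<close> in the
    sum. If there is none, the conjugate of \<open>p\<close> by \<open>g\<close> lies outside the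
    image of \<open>\<iota>\<close>, and conjugating further by \<open>\<iota> a\<close> cannot
    bring it into \<open>S\<close>.\<close>
  have inner: "(\<Sum>h | h \<in> carrier K \<and> \<iota> h = inv\<^bsub>G\<^esub> g \<otimes>\<^bsub>G\<^esub> p \<otimes>\<^bsub>G\<^esub> g.
        of_bool (inv\<^bsub>K\<^esub> a \<otimes>\<^bsub>K\<^esub> h \<otimes>\<^bsub>K\<^esub> a \<in> T)) =
      (of_bool (inv\<^bsub>G\<^esub> (g \<otimes>\<^bsub>G\<^esub> \<iota> a) \<otimes>\<^bsub>G\<^esub> p \<otimes>\<^bsub>G\<^esub> (g \<otimes>\<^bsub>G\<^esub> \<iota> a) \<in> S) :: complex)"
    (is "sum _ ?H = _") if g: "g \<in> carrier G" and a: "a \<in> carrier K" for g a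
  proof -
    have conj: "inv\<^bsub>G\<^esub> (g \<otimes>\<^bsub>G\<^esub> \<iota> a) \<otimes>\<^bsub>G\<^esub> p \<otimes>\<^bsub>G\<^esub> (g \<otimes>\<^bsub>G\<^esub> \<iota> a) =
        inv\<^bsub>G\<^esub> (\<iota> a) \<otimes>\<^bsub>G\<^esub> (inv\<^bsub>G\<^esub> g \<otimes>\<^bsub>G\<^esub> p \<otimes>\<^bsub>G\<^esub> g) \<otimes>\<^bsub>G\<^esub> \<iota> a"
      using g a p by (simp add: G.inv_mult_group G.m_assoc)
    show ?thesis
    proof (cases "\<exists>h\<in>carrier K. \<iota> h = inv\<^bsub>G\<^esub> g \<otimes>\<^bsub>G\<^esub> p \<otimes>\<^bsub>G\<^esub> g")
      case True
      then obtain h where h: "h \<in> carrier K" "\<iota> h = inv\<^bsub>G\<^esub> g \<otimes>\<^bsub>G\<^esub> p \<otimes>\<^bsub>G\<^esub> g" by blast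
      have H: "?H = {h}"
        using inj h(1) unfolding h(2)[symmetric] by (auto dest: inj_onD)
      have "inv\<^bsub>G\<^esub> (g \<otimes>\<^bsub>G\<^esub> \<iota> a) \<otimes>\<^bsub>G\<^esub> p \<otimes>\<^bsub>G\<^esub> (g \<otimes>\<^bsub>G\<^esub> \<iota> a) = \<iota> (inv\<^bsub>K\<^esub> a \<otimes>\<^bsub>K\<^esub> h \<otimes>\<^bsub>K\<^esub> a)"
        unfolding conj h(2)[symmetric] using h(1) a by simp
      moreover have "\<iota> (inv\<^bsub>K\<^esub> a \<otimes>\<^bsub>K\<^esub> h \<otimes>\<^bsub>K\<^esub> a) \<in> S \<longleftrightarrow> inv\<^bsub>K\<^esub> a \<otimes>\<^bsub>K\<^esub> h \<otimes>\<^bsub>K\<^esub> a \<in> T"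
        unfolding ST by (rule inj_on_image_mem_iff[OF inj _ T]) (use h(1) a in simp)
      ultimately show ?thesis unfolding H by simp
    next
      case False
      have "inv\<^bsub>G\<^esub> (g \<otimes>\<^bsub>G\<^esub> \<iota> a) \<otimes>\<^bsub>G\<^esub> p \<otimes>\<^bsub>G\<^esub> (g \<otimes>\<^bsub>G\<^esub> \<iota> a) \<notin> S"
      proof
        assume "inv\<^bsub>G\<^esub> (g \<otimes>\<^bsub>G\<^esub> \<iota> a) \<otimes>\<^bsub>G\<^esub> p \<otimes>\<^bsub>G\<^esub> (g \<otimes>\<^bsub>G\<^esub> \<iota> a) \<in> S"
        then obtain t where t: "t \<in> carrier K"
          "\<iota> t = inv\<^bsub>G\<^esub> (\<iota> a) \<otimes>\<^bsub>G\<^esub> (inv\<^bsub>G\<^esub> g \<otimes>\<^bsub>G\<^esub> p \<otimes>\<^bsub>G\<^esub> g) \<otimes>\<^bsub>G\<^esub> \<iota> a"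
          unfolding conj ST using T by (metis imageE subsetD)
        have cancel: "\<iota> a \<otimes>\<^bsub>G\<^esub> (inv\<^bsub>G\<^esub> (\<iota> a) \<otimes>\<^bsub>G\<^esub> w) = w" if "w \<in> carrier G" for w
          using a that by (simp add: G.m_assoc[symmetric])
        \<comment> \<open>Conjugating \<open>t\<close> back by \<open>a\<close> produces the
          preimage under \<open>\<iota>\<close> that was assumed not to exist.\<close>
        have "\<iota> (a \<otimes>\<^bsub>K\<^esub> t \<otimes>\<^bsub>K\<^esub> inv\<^bsub>K\<^esub> a) =
            \<iota> a \<otimes>\<^bsub>G\<^esub> (inv\<^bsub>G\<^esub> (\<iota> a) \<otimes>\<^bsub>G\<^esub> (inv\<^bsub>G\<^esub> g \<otimes>\<^bsub>G\<^esub> p \<otimes>\<^bsub>G\<^esub> g) \<otimes>\<^bsub>G\<^esub> \<iota> a) \<otimes>\<^bsub>G\<^esub> inv\<^bsub>G\<^esub> (\<iota> a)"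
          using t a by simp
        also have "\<dots> = inv\<^bsub>G\<^esub> g \<otimes>\<^bsub>G\<^esub> p \<otimes>\<^bsub>G\<^esub> g"
          using g a p by (simp add: G.m_assoc cancel)
        finally show False using False t a by (meson K.inv_closed K.m_closed)
      qed
      moreover from False have H: "?H = {}" by blast
      ultimately show ?thesis by (simp only: H sum.empty of_bool_eq)
    qed
  qed
  \<comment> \<open>For fixed \<open>a\<close>, right translation by \<open>\<iota> a\<close>
    permutes \<open>carrier G\<close>, so every \<open>a\<close> contributes the same count.\<close>
  have translate: "(\<Sum>g\<in>carrier G. of_bool
      (inv\<^bsub>G\<^esub> (g \<otimes>\<^bsub>G\<^esub> \<iota> a) \<otimes>\<^bsub>G\<^esub> p \<otimes>\<^bsub>G\<^esub> (g \<otimes>\<^bsub>G\<^esub> \<iota> a) \<in> S)) = N"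
    if a: "a \<in> carrier K" for a
    unfolding N_def
  proof (rule sum.reindex_bij_betw)
    show "bij_betw (\<lambda>g. g \<otimes>\<^bsub>G\<^esub> \<iota> a) (carrier G) (carrier G)"
      by (rule bij_betw_byWitness[where f' = "\<lambda>g. g \<otimes>\<^bsub>G\<^esub> inv\<^bsub>G\<^esub> (\<iota> a)"])
        (use a in \<open>auto simp: G.m_assoc\<close>)
  qed
  have "(\<Sum>g\<in>carrier G. \<Sum>h | h \<in> carrier K \<and> \<iota> h = inv\<^bsub>G\<^esub> g \<otimes>\<^bsub>G\<^esub> p \<otimes>\<^bsub>G\<^esub> g.
        perm_character \<psi> (orbit K \<psi> y) h) * of_nat (card T) =
      (\<Sum>g\<in>carrier G. \<Sum>h | h \<in> carrier K \<and> \<iota> h = inv\<^bsub>G\<^esub> g \<otimes>\<^bsub>G\<^esub> p \<otimes>\<^bsub>G\<^esub> g.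
        \<Sum>a\<in>carrier K. of_bool (inv\<^bsub>K\<^esub> a \<otimes>\<^bsub>K\<^esub> h \<otimes>\<^bsub>K\<^esub> a \<in> T))"
    unfolding sum_distrib_right T_def
    by (intro sum.cong refl K.perm_character_orbit K) auto
  \<comment> \<open>Summing over \<open>h\<close> first, with \<open>a\<close> fixed, makes
    \<open>inner\<close> applicable.\<close>
  also have "\<dots> = (\<Sum>g\<in>carrier G. \<Sum>a\<in>carrier K.
      of_bool (inv\<^bsub>G\<^esub> (g \<otimes>\<^bsub>G\<^esub> \<iota> a) \<otimes>\<^bsub>G\<^esub> p \<otimes>\<^bsub>G\<^esub> (g \<otimes>\<^bsub>G\<^esub> \<iota> a) \<in> S))"
    by (rule sum.cong[OF refl], subst sum.swap, rule sum.cong[OF refl], rule inner)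
  also have "\<dots> = of_nat (order K) * N"
    by (subst sum.swap) (simp add: translate order_def)
  finally have "induced G K \<iota> (perm_character \<psi> (orbit K \<psi> y)) p * of_nat (card T) = N"
    using oK unfolding induced_def by (simp add: field_simps)
  moreover have "perm_character \<phi> (orbit G \<phi> x) p * of_nat (card T) = N"
    using G.perm_character_orbit[OF G(2,3) p] cT(2) by (simp add: N_def S_def)
  ultimately show ?thesis
    using cT(1) by (metis mult_right_cancel of_nat_eq_0_iff)
qed

lemma orbit_DirProd:
  "orbit (G \<times>\<times> H) (\<lambda>(a, b). map_prod (\<phi> a) (\<psi> b)) (x, y) = orbit G \<phi> x \<times> orbit H \<psi> y"
  by (auto simp: orbit_def)

text \<open>The permutation matrix on pairs is a Kronecker product, whose trace is the product of
  the traces.\<close>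

lemma perm_character_map_prod:
  "perm_character (\<lambda>(a, b). map_prod (\<phi> a) (\<psi> b)) (X \<times> Y) (a, b) =
    perm_character \<phi> X a * perm_character \<psi> Y b"
  unfolding perm_character_def sum_product sum.cartesian_product
  by (rule sum.cong) (auto simp: perm_rep_def)


section \<open>Relabelings of rooted graphs\<close>

lemma relabel_id: "relabel id = id"
  by (simp add: relabel_def fun_eq_iff)

lemma relabel_comp: "relabel (f \<circ> g) = relabel f \<circ> relabel g"
  by (simp add: relabel_def fun_eq_iff image_comp comp_def)

lemma relabel_relabel: "relabel f (relabel g G) = relabel (f \<circ> g) G"
  by (simp add: relabel_comp)

lemma rooted_graphD:
  assumes "rooted_graph G"
  shows "e \<in> edges G \<Longrightarrow> e \<subseteq> verts G" and "e \<in> edges G \<Longrightarrow> e \<noteq> {}" and "roots G \<subseteq> verts G"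
  using assms by (auto simp: rooted_graph_def)

lemma relabel_cong:
  assumes G: "rooted_graph G" and eq: "\<And>v. v \<in> verts G \<Longrightarrow> f v = g v"
  shows "relabel f G = relabel g G"
proof -
  have "f ` A = g ` A" if "A \<subseteq> verts G" for A
    using that eq by (intro image_cong) auto
  then show ?thesis
    using rooted_graphD[OF G] by (auto simp: relabel_def intro!: image_cong)
qed

lemma inj_image: "inj f \<Longrightarrow> inj ((`) f)"
  by (rule injI) (simp add: inj_image_eq_iff)

lemma inj_relabel:
  assumes "inj f"
  shows "inj (relabel f)"
proof (rule injI)
  fix G H :: "'a rooted_graph" assume "relabel f G = relabel f H"
  then have "f ` verts G = f ` verts H" "(`) f ` edges G = (`) f ` edges H" "f ` roots G = f ` roots H"
    by (simp_all add: relabel_def)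
  then show "G = H"
    by (simp add: inj_image_eq_iff[OF assms] inj_image_eq_iff[OF inj_image[OF assms]])
qed

lemma rooted_graph_relabel:
  assumes "rooted_graph G" and "inj_on f (verts G)"
  shows "rooted_graph (relabel f G)"
proof -
  have "card (f ` e) = 2" if "e \<subseteq> verts G" "card e = 2" for e
    using that card_image[OF inj_on_subset[OF assms(2)]] by metis
  then show ?thesis
    using assms(1) by (auto simp: rooted_graph_def relabel_def image_mono)
qed

text \<open>Acting on all rooted graphs over the naturals, rather than on the forests labeled by
  \<open>{1..n}\<close>, avoids any closure condition; orbits and stabilizers are the same.\<close>

lemma group_action_relabel: "group_action (sym_group n) UNIV relabel"
  by (rule group_action_UNIV)
    (simp_all add: sym_group_is_group sym_group_one sym_group_mult relabel_id relabel_comp)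

text \<open>This allows passing to a convenient representative of the isomorphism class.\<close>

lemma orbit_relabel:
  assumes "h permutes {1..n}"
  shows "orbit (sym_group n) relabel (relabel h G) = orbit (sym_group n) relabel G"
proof -
  interpret group_action "sym_group n" UNIV relabel by (rule group_action_relabel)
  have "relabel h G \<in> orbit (sym_group n) relabel G"
    using assms by (auto simp: orbit_def sym_group_carrier)
  then show ?thesis
    using orbit_sym orbit_trans by blast
qed

lemma finite_sym_group: "finite (carrier (sym_group n))"
  by (simp add: sym_group_def finite_permutations)


section \<open>Disjoint unions and components\<close>

lemma is_disjoint_union_commute: "is_disjoint_union \<sigma> \<tau> \<nu> \<Longrightarrow> is_disjoint_union \<sigma> \<nu> \<tau>"
  by (auto simp: is_disjoint_union_def)

lemma is_disjoint_union_relabel: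
  assumes "is_disjoint_union \<sigma> \<tau> \<nu>" and "inj_on f (verts \<sigma>)"
  shows "is_disjoint_union (relabel f \<sigma>) (relabel f \<tau>) (relabel f \<nu>)"
  using assms by (auto simp: is_disjoint_union_def relabel_def image_Un inj_on_def)

text \<open>Edges of \<open>\<nu>\<close> are nonempty and avoid \<open>verts \<tau>\<close>, so
  none survives the restriction. Hence a summand is determined by the union and its own vertex
  set.\<close>

lemma is_disjoint_union_induced:
  assumes "is_disjoint_union \<sigma> \<tau> \<nu>" and "rooted_graph \<tau>" and "rooted_graph \<nu>"
  shows "induced_subgraph \<sigma> (verts \<tau>) = \<tau>"
proof -
  have sub: "\<not> A \<subseteq> verts \<tau>" if "A \<subseteq> verts \<nu>" "A \<noteq> {}" for A
    using assms(1) that by (auto simp: is_disjoint_union_def)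
  have "{e \<in> edges \<sigma>. e \<subseteq> verts \<tau>} = edges \<tau>"
    using assms(1) rooted_graphD(1)[OF assms(2)] rooted_graphD(1,2)[OF assms(3)] sub
    unfolding is_disjoint_union_def by fastforce
  moreover have "roots \<sigma> \<inter> verts \<tau> = roots \<tau>"
    using assms(1) rooted_graphD(3)[OF assms(2)] rooted_graphD(3)[OF assms(3)]
    by (auto simp: is_disjoint_union_def)
  ultimately show ?thesis by (simp add: induced_subgraph_def)
qed

text \<open>Indexing components by a vertex makes it possible to follow one of them along a map of
  vertices.\<close>

definition component_at :: "'a rooted_graph \<Rightarrow> 'a \<Rightarrow> 'a rooted_graph" where
  "component_at G v = induced_subgraph G {w \<in> verts G. (v, w) \<in> (adjacency G)\<^sup>*}"

lemma components_eq: "components G = component_at G ` verts G"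
  by (simp add: components_def component_at_def)

text \<open>A path starting in \<open>\<tau>\<close> never leaves it, since each edge of the union
  lies entirely in one summand.\<close>

lemma component_at_disjoint_union:
  assumes du: "is_disjoint_union \<sigma> \<tau> \<nu>" and \<tau>: "rooted_graph \<tau>" and \<nu>: "rooted_graph \<nu>"
    and v: "v \<in> verts \<tau>"
  shows "component_at \<sigma> v = component_at \<tau> v"
proof -
  note D = rooted_graphD[OF \<tau>] rooted_graphD[OF \<nu>]
  have "(v, w) \<in> (adjacency \<tau>)\<^sup>* \<and> w \<in> verts \<tau>" if "(v, w) \<in> (adjacency \<sigma>)\<^sup>*" for w
    using that
  proof induction
    case base
    then show ?case using v by simp
  next
    case (step a b)
    then have "{a, b} \<in> edges \<tau>"
      using du D(4)[of "{a, b}"] by (auto simp: adjacency_def is_disjoint_union_def)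
    then have "(a, b) \<in> adjacency \<tau>" "b \<in> verts \<tau>"
      using D(1)[of "{a, b}"] by (auto simp: adjacency_def)
    then show ?case using step.IH by auto
  qed
  moreover have "(adjacency \<tau>)\<^sup>* \<subseteq> (adjacency \<sigma>)\<^sup>*"
    using du by (intro rtrancl_mono) (auto simp: adjacency_def is_disjoint_union_def)
  ultimately have set: "{w \<in> verts \<sigma>. (v, w) \<in> (adjacency \<sigma>)\<^sup>*} = {w \<in> verts \<tau>. (v, w) \<in> (adjacency \<tau>)\<^sup>*}"
    (is "_ = ?W") using du by (auto simp: is_disjoint_union_def)
  \<comment> \<open>As \<open>?W\<close> lies in \<open>verts \<tau>\<close>, the restriction can be
    made in two stages, the first of which yields \<open>\<tau>\<close>.\<close>
  have "induced_subgraph \<sigma> ?W = induced_subgraph (induced_subgraph \<sigma> (verts \<tau>)) ?W"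
    by (auto simp: induced_subgraph_def)
  then show ?thesis
    by (simp add: component_at_def set is_disjoint_union_induced[OF du \<tau> \<nu>])
qed

lemma relabel_component_at:
  assumes f: "bij f"
  shows "relabel f (component_at G v) = component_at (relabel f G) (f v)"
proof -
  have inj: "inj f" using f by (rule bij_is_inj)
  have adj: "(f u, f w) \<in> adjacency (relabel f G) \<longleftrightarrow> (u, w) \<in> adjacency G" for u w
  proof -
    have "{f u, f w} = f ` {u, w}" by simp
    then show ?thesis
      by (simp only: adjacency_def relabel_def mem_Collect_eq case_prod_conv
          rooted_graph.simps inj_image_mem_iff[OF inj_image[OF inj]])
  qed
  have fwd: "(f u, f w) \<in> (adjacency (relabel f G))\<^sup>*" if "(u, w) \<in> (adjacency G)\<^sup>*" for u w
    using that by induction (auto simp: adj intro: rtrancl_into_rtrancl)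
  have bwd: "\<exists>w. w' = f w \<and> (u, w) \<in> (adjacency G)\<^sup>*"
    if "(f u, w') \<in> (adjacency (relabel f G))\<^sup>*" for u w'
    using that
  proof induction
    case base
    then show ?case by auto
  next
    \<comment> \<open>Surjectivity of \<open>f\<close> provides a preimage of the next vertex, so
      the path can be pulled back edge by edge.\<close>
    case (step a b)
    obtain b' where "b = f b'" using bij_is_surj[OF f] by (metis surjD)
    then show ?case using step by (auto simp: adj intro: rtrancl_into_rtrancl)
  qed
  have reach: "(f u, f w) \<in> (adjacency (relabel f G))\<^sup>* \<longleftrightarrow> (u, w) \<in> (adjacency G)\<^sup>*" for u w
    using fwd bwd[of u "f w"] by (auto simp only: inj_eq[OF inj])
  have verts: "verts (relabel f G) = f ` verts G" by (simp add: relabel_def)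
  have set: "{w \<in> verts (relabel f G). (f v, w) \<in> (adjacency (relabel f G))\<^sup>*} =
      f ` {w \<in> verts G. (v, w) \<in> (adjacency G)\<^sup>*}"
    unfolding verts by (auto simp: reach)
  have "{e \<in> (`) f ` edges G. e \<subseteq> f ` S} = (`) f ` {e \<in> edges G. e \<subseteq> S}" for S
    by (auto simp: inj_image_subset_iff[OF inj])
  then have "relabel f (induced_subgraph G S) = induced_subgraph (relabel f G) (f ` S)" for S
    by (simp add: relabel_def induced_subgraph_def image_Int[OF inj])
  then show ?thesis
    by (simp only: component_at_def set)
qed

text \<open>An automorphism carries the component of \<open>v\<close> isomorphically onto that of
  \<open>y v\<close>. If \<open>v\<close> were in \<open>\<tau>\<close> and \<open>y v\<close> in
  \<open>\<nu>\<close>, the two forests would share a component type.\<close>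

lemma automorphism_preserves_part:
  assumes du: "is_disjoint_union \<sigma> \<tau> \<nu>" and \<tau>: "rooted_graph \<tau>" and \<nu>: "rooted_graph \<nu>"
    and no_common: "\<forall>C\<in>components \<tau>. \<forall>D\<in>components \<nu>. \<not> rooted_isomorphic C D"
    and y: "bij y" "relabel y \<sigma> = \<sigma>"
  shows "y ` verts \<tau> \<subseteq> verts \<tau>"
proof
  fix w assume "w \<in> y ` verts \<tau>"
  then obtain v where v: "v \<in> verts \<tau>" "w = y v" by blast
  have "y ` verts \<sigma> = verts \<sigma>"
    using y(2) by (metis relabel_def rooted_graph.select_convs(1))
  then have w: "w \<in> verts \<tau> \<union> verts \<nu>"
    using du v by (auto simp: is_disjoint_union_def)
  show "w \<in> verts \<tau>"
  proof (rule ccontr)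
    assume "w \<notin> verts \<tau>"
    then have w\<nu>: "w \<in> verts \<nu>" using w by simp
    have "component_at \<nu> w = component_at \<sigma> (y v)"
      using component_at_disjoint_union[OF is_disjoint_union_commute[OF du] \<nu> \<tau> w\<nu>] v by simp
    also have "\<dots> = relabel y (component_at \<tau> v)"
      using relabel_component_at[OF y(1), of \<sigma> v] y(2)
        component_at_disjoint_union[OF du \<tau> \<nu> v(1)] by simp
    finally have eq: "relabel y (component_at \<tau> v) = component_at \<nu> w" ..
    have "bij_betw y (verts (component_at \<tau> v)) (verts (component_at \<nu> w))"
      unfolding eq[symmetric] relabel_def using bij_is_inj[OF y(1)]
      by (auto simp: bij_betw_def intro: inj_on_subset)
    then have "rooted_isomorphic (component_at \<tau> v) (component_at \<nu> w)"
      using eq by (auto simp: rooted_isomorphic_def)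
    then show False
      using no_common v(1) w\<nu> by (auto simp: components_eq)
  qed
qed


section \<open>The stabilizer of a disjoint union\<close>

text \<open>By finiteness the injective \<open>y\<close> maps \<open>{1..m}\<close> onto itself,
  hence also its complement \<open>{m + 1..m + k}\<close>. The factors are the two restrictions, the
  second shifted down by \<open>m\<close>.\<close>

lemma young_embed_surj:
  assumes y: "y permutes {1..m + k}" and part: "y ` {1..m} \<subseteq> {1..m}"
  shows "\<exists>\<alpha> \<beta>. \<alpha> permutes {1..m} \<and> \<beta> permutes {1..k} \<and> young_embed m (\<alpha>, \<beta>) = y"
proof -
  have inj: "inj y" using y by (rule permutes_inj)
  have im: "y ` {1..m} = {1..m}"
    using endo_inj_surj[OF _ part inj_on_subset[OF inj subset_UNIV]] by simp
  have "y ` ({1..m + k} - {1..m}) = {1..m + k} - {1..m}"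
    using image_set_diff[OF inj] permutes_image[OF y] im by simp
  moreover have "{1..m + k} - {1..m} = {m + 1..m + k}" by auto
  ultimately have im': "y ` {m + 1..m + k} = {m + 1..m + k}" by simp
  define \<alpha> where "\<alpha> i = (if i \<in> {1..m} then y i else i)" for i
  define \<beta> where "\<beta> i = (if i \<in> {1..k} then y (m + i) - m else i)" for i
  have \<alpha>: "\<alpha> permutes {1..m}"
  proof (rule bij_imp_permutes)
    have "bij_betw y {1..m} {1..m}"
      using im inj_on_subset[OF inj subset_UNIV] by (simp add: bij_betw_def)
    then show "bij_betw \<alpha> {1..m} {1..m}"
      by (rule bij_betw_cong[THEN iffD1, rotated]) (simp add: \<alpha>_def)
  qed (simp only: \<alpha>_def if_False)
  have y_shift: "y (m + i) \<in> {m + 1..m + k}" if "i \<in> {1..k}" for i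
  proof -
    have "m + i \<in> {m + 1..m + k}" using that by simp
    then show ?thesis using im' by blast
  qed
  have \<beta>: "\<beta> permutes {1..k}"
  proof (rule bij_imp_permutes)
    have "inj_on \<beta> {1..k}"
    proof (rule inj_onI)
      fix i j assume ij: "i \<in> {1..k}" "j \<in> {1..k}" "\<beta> i = \<beta> j"
      then have "y (m + i) - m = y (m + j) - m"
        by (simp add: \<beta>_def)
      \<comment> \<open>Both values exceed \<open>m\<close>, so truncated subtraction loses
        nothing.\<close>
      then have "y (m + i) = y (m + j)"
        using y_shift[OF ij(1)] y_shift[OF ij(2)] unfolding atLeastAtMost_iff by linarith
      then show "i = j" by (simp add: inj_eq[OF inj])
    qed
    moreover have "\<beta> ` {1..k} \<subseteq> {1..k}"
      using y_shift by (fastforce simp: \<beta>_def)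
    ultimately show "bij_betw \<beta> {1..k} {1..k}"
      by (simp add: bij_betw_def endo_inj_surj)
  qed (simp only: \<beta>_def if_False)
  have "young_embed m (\<alpha>, \<beta>) i = y i" for i
  proof (cases "i \<in> {1..m + k}")
    \<comment> \<open>Here \<open>i = 0\<close> falls under the first branch of
      \<open>young_embed\<close> and \<open>i > m + k\<close> under the second; both factors act
      trivially there.\<close>
    case False
    then show ?thesis
      using permutes_not_in[OF y False] by (auto simp: young_embed_def \<alpha>_def \<beta>_def)
  next
    case True
    then show ?thesis
      using y_shift[of "i - m"] by (auto simp: young_embed_def \<alpha>_def \<beta>_def)
  qed
  then show ?thesis using \<alpha> \<beta> by blast
qed

text \<open>The embedded permutation relabels each summand separately and keeps its vertex set.
  Fixing the union therefore means fixing both summands, which are recovered as induced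
  subgraphs.\<close>

lemma young_embed_fixes_iff:
  assumes \<tau>: "rooted_graph \<tau>" "verts \<tau> = {1..m}" and \<nu>: "rooted_graph \<nu>" "verts \<nu> = {1..k}"
    and du: "is_disjoint_union \<sigma> \<tau> (relabel ((+) m) \<nu>)"
    and \<alpha>: "\<alpha> permutes {1..m}" and \<beta>: "\<beta> permutes {1..k}"
  shows "relabel (young_embed m (\<alpha>, \<beta>)) \<sigma> = \<sigma> \<longleftrightarrow> relabel \<alpha> \<tau> = \<tau> \<and> relabel \<beta> \<nu> = \<nu>"
proof -
  let ?y = "young_embed m (\<alpha>, \<beta>)" and ?s = "relabel ((+) m)"
  have "?y permutes {1..m + k}"
    using young_embed_mon[of m k] \<alpha> \<beta> by (auto simp: mon_def hom_def sym_group_carrier)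
  then have "inj_on ?y (verts \<sigma>)"
    using permutes_inj inj_on_subset by blast
  then have "is_disjoint_union (relabel ?y \<sigma>) (relabel ?y \<tau>) (relabel ?y (?s \<nu>))"
    by (rule is_disjoint_union_relabel[OF du])
  moreover have "relabel ?y \<tau> = relabel \<alpha> \<tau>"
    by (rule relabel_cong[OF \<tau>(1)]) (simp add: \<tau>(2) young_embed_def)
  \<comment> \<open>On \<open>{1..k}\<close> the shift by \<open>m\<close> intertwines
    \<open>\<beta>\<close> with the embedded permutation.\<close>
  moreover have "relabel ?y (?s \<nu>) = ?s (relabel \<beta> \<nu>)"
    unfolding relabel_relabel
    by (rule relabel_cong[OF \<nu>(1)]) (auto simp: \<nu>(2) young_embed_def)
  ultimately have du': "is_disjoint_union (relabel ?y \<sigma>) (relabel \<alpha> \<tau>) (?s (relabel \<beta> \<nu>))"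
    by simp
  have rg: "rooted_graph (relabel \<alpha> \<tau>)" "rooted_graph (relabel \<beta> \<nu>)"
    using rooted_graph_relabel \<tau>(1) \<nu>(1) permutes_inj[OF \<alpha>] permutes_inj[OF \<beta>] inj_on_subset
    by blast+
  have rgs: "rooted_graph (?s G)" if "rooted_graph G" for G
    using that by (rule rooted_graph_relabel) simp
  have verts: "verts (relabel \<alpha> \<tau>) = verts \<tau>" "verts (?s (relabel \<beta> \<nu>)) = verts (?s \<nu>)"
    using permutes_image[OF \<alpha>] permutes_image[OF \<beta>] by (simp_all add: relabel_def \<tau>(2) \<nu>(2))
  show ?thesis
  proof
    assume fixed: "relabel ?y \<sigma> = \<sigma>"
    have "relabel \<alpha> \<tau> = \<tau>"
      using is_disjoint_union_induced[OF du \<tau>(1) rgs[OF \<nu>(1)]]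
        is_disjoint_union_induced[OF du' rg(1) rgs[OF rg(2)]] fixed verts(1) by simp
    moreover have "?s (relabel \<beta> \<nu>) = ?s \<nu>"
      using is_disjoint_union_induced[OF is_disjoint_union_commute[OF du] rgs[OF \<nu>(1)] \<tau>(1)]
        is_disjoint_union_induced[OF is_disjoint_union_commute[OF du'] rgs[OF rg(2)] rg(1)]
        fixed verts(2) by simp
    ultimately show "relabel \<alpha> \<tau> = \<tau> \<and> relabel \<beta> \<nu> = \<nu>"
      using injD[OF inj_relabel[of "(+) m"]] by auto
  next
    assume "relabel \<alpha> \<tau> = \<tau> \<and> relabel \<beta> \<nu> = \<nu>"
    then show "relabel ?y \<sigma> = \<sigma>"
      using du du' by (simp add: is_disjoint_union_def)
  qed
qed

section \<open>Reduction to the standard labeling and the character identity\<close>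

theorem mainTheorem5:
  fixes m k :: nat and \<sigma> \<tau> \<nu> :: "nat rooted_graph" and f g :: "nat \<Rightarrow> nat"
  assumes "labeled_rooted_forest (m + k) \<sigma>"
    and "rooted_forest \<tau>" and "card (verts \<tau>) = m"
    and "rooted_forest \<nu>" and "card (verts \<nu>) = k"
    and "is_disjoint_union \<sigma> \<tau> \<nu>"
    and "\<forall>C\<in>components \<tau>. \<forall>D\<in>components \<nu>. \<not> rooted_isomorphic C D"
    and "bij_betw f (verts \<tau>) {1..m}"
    and "bij_betw g (verts \<nu>) {1..k}"
  shows "\<forall>\<pi>\<in>carrier (sym_group (m + k)).
    orbit_character (m + k) \<sigma> \<pi> =
      induction_product m k
        (orbit_character m (relabel f \<tau>)) (orbit_character k (relabel g \<nu>)) \<pi>"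
proof
  fix \<pi> assume \<pi>: "\<pi> \<in> carrier (sym_group (m + k))"
  have \<tau>: "rooted_graph \<tau>" and \<nu>: "rooted_graph \<nu>"
    using assms(2,4) by (simp_all add: rooted_forest_def)
  note du = assms(6) and f = assms(8) and g = assms(9)
  have V: "verts \<tau> \<union> verts \<nu> = {1..m + k}" "verts \<tau> \<inter> verts \<nu> = {}"
    using assms(1) du by (auto simp: labeled_rooted_forest_def is_disjoint_union_def)
  \<comment> \<open>The labelings \<open>f\<close> and \<open>g\<close> are glued into one
    permutation of \<open>{1..m + k}\<close>; the shift of \<open>g\<close> separates their ranges
    and matches the convention of \<open>young_embed\<close>.\<close>
  define h where "h v = (if v \<in> verts \<tau> then f v else if v \<in> verts \<nu> then m + g v else v)" for v
  have "bij_betw h (verts \<tau>) {1..m}"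
    using f by (rule bij_betw_cong[THEN iffD1, rotated]) (simp add: h_def)
  moreover have "bij_betw h (verts \<nu>) {m + 1..m + k}"
  proof -
    have "bij_betw ((+) m) {1..k} {m + 1..m + k}"
      by (simp add: bij_betw_def add.commute)
    from bij_betw_trans[OF g this] show ?thesis
      by (rule bij_betw_cong[THEN iffD1, rotated]) (use V(2) in \<open>auto simp: h_def\<close>)
  qed
  ultimately have "bij_betw h (verts \<tau> \<union> verts \<nu>) ({1..m} \<union> {m + 1..m + k})"
    by (rule bij_betw_combine) auto
  moreover have "{1..m} \<union> {m + 1..m + k} = {1..m + k}" by auto
  ultimately have "bij_betw h {1..m + k} {1..m + k}" using V(1) by simp
  then have h: "h permutes {1..m + k}"
    by (rule bij_imp_permutes) (use V(1) in \<open>auto simp: h_def\<close>)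
  define \<sigma>' where "\<sigma>' = relabel h \<sigma>"
  define \<tau>' where "\<tau>' = relabel f \<tau>"
  define \<nu>' where "\<nu>' = relabel g \<nu>"
  have h\<tau>: "relabel h \<tau> = \<tau>'"
    unfolding \<tau>'_def by (rule relabel_cong[OF \<tau>]) (simp add: h_def)
  have h\<nu>: "relabel h \<nu> = relabel ((+) m) \<nu>'"
    unfolding \<nu>'_def relabel_relabel
    by (rule relabel_cong[OF \<nu>]) (use V(2) in \<open>auto simp: h_def\<close>)
  have du': "is_disjoint_union \<sigma>' \<tau>' (relabel ((+) m) \<nu>')"
    unfolding \<sigma>'_def h\<tau>[symmetric] h\<nu>[symmetric]
    by (rule is_disjoint_union_relabel[OF du]) (use permutes_inj[OF h] inj_on_subset in blast)
  have \<tau>': "rooted_graph \<tau>'" "verts \<tau>' = {1..m}"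
    unfolding \<tau>'_def using rooted_graph_relabel[OF \<tau> bij_betw_imp_inj_on[OF f]]
      bij_betw_imp_surj_on[OF f] by (simp_all only: relabel_def rooted_graph.simps)
  have \<nu>': "rooted_graph \<nu>'" "verts \<nu>' = {1..k}"
    unfolding \<nu>'_def using rooted_graph_relabel[OF \<nu> bij_betw_imp_inj_on[OF g]]
      bij_betw_imp_surj_on[OF g] by (simp_all only: relabel_def rooted_graph.simps)
  \<comment> \<open>Conjugation by \<open>h\<close> turns an automorphism of
    \<open>\<sigma>'\<close> into one of \<open>\<sigma>\<close>, to which the absence of common
    components applies.\<close>
  have part: "y ` {1..m} \<subseteq> {1..m}" if y: "y permutes {1..m + k}" "relabel y \<sigma>' = \<sigma>'" for y
  proof -
    let ?z = "inv' h \<circ> y \<circ> h"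
    have "relabel ?z \<sigma> = relabel (inv' h \<circ> h) \<sigma>"
      using y(2) by (simp add: relabel_comp \<sigma>'_def)
    then have "relabel ?z \<sigma> = \<sigma>"
      by (simp add: permutes_inv_o[OF h] relabel_id)
    moreover have "bij ?z"
      using permutes_bij h y(1) permutes_inv by (blast intro: bij_comp)
    ultimately have "?z ` verts \<tau> \<subseteq> verts \<tau>"
      using automorphism_preserves_part[OF du \<tau> \<nu> assms(7)] by blast
    then have "h ` ?z ` verts \<tau> \<subseteq> h ` verts \<tau>" by (rule image_mono)
    moreover have "h ` verts \<tau> = {1..m}"
      using h\<tau> \<tau>'(2) by (simp add: relabel_def rooted_graph.splits) (metis rooted_graph.select_convs(1))
    \<comment> \<open>Since \<open>h\<close> after \<open>?z\<close> equals \<open>y\<close> after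
      \<open>h\<close>, the inclusion for \<open>verts \<tau>\<close> becomes the one for
      \<open>{1..m}\<close>.\<close>
    ultimately show ?thesis
      by (simp add: image_comp[symmetric] permutes_inverses(1)[OF h] image_image)
        (metis image_image image_subset_iff imageI)
  qed
  let ?K = "sym_group m \<times>\<times> sym_group k"
  let ?\<psi> = "\<lambda>(\<alpha>, \<beta>). map_prod (relabel \<alpha>) (relabel \<beta>) ::
    nat rooted_graph \<times> nat rooted_graph \<Rightarrow> nat rooted_graph \<times> nat rooted_graph"
  have actK: "group_action ?K UNIV ?\<psi>"
    by (rule group_action_UNIV)
      (auto simp: DirProd_group sym_group_is_group sym_group_one sym_group_mult
        relabel_id relabel_comp map_prod.comp prod.map_id0)
  \<comment> \<open>With the blocks in standard position, every automorphism of
    \<open>\<sigma>'\<close> splits into an automorphism of \<open>\<tau>'\<close> and one of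
    \<open>\<nu>'\<close>.\<close>
  have stab: "stabilizer (sym_group (m + k)) relabel \<sigma>' =
      young_embed m ` stabilizer ?K ?\<psi> (\<tau>', \<nu>')"
  proof (intro equalityI subsetI)
    fix y assume "y \<in> stabilizer (sym_group (m + k)) relabel \<sigma>'"
    then have y: "y permutes {1..m + k}" "relabel y \<sigma>' = \<sigma>'"
      by (auto simp: stabilizer_def sym_group_carrier)
    obtain \<alpha> \<beta> where ab: "\<alpha> permutes {1..m}" "\<beta> permutes {1..k}" "young_embed m (\<alpha>, \<beta>) = y"
      using young_embed_surj[OF y(1) part[OF y]] by blast
    then have "(\<alpha>, \<beta>) \<in> stabilizer ?K ?\<psi> (\<tau>', \<nu>')"
      using young_embed_fixes_iff[OF \<tau>' \<nu>' du' ab(1,2)] y(2)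
      by (simp add: stabilizer_def sym_group_carrier)
    then show "y \<in> young_embed m ` stabilizer ?K ?\<psi> (\<tau>', \<nu>')"
      using ab(3) by (metis imageI)
  next
    fix y assume "y \<in> young_embed m ` stabilizer ?K ?\<psi> (\<tau>', \<nu>')"
    then obtain \<alpha> \<beta> where ab: "\<alpha> permutes {1..m}" "\<beta> permutes {1..k}"
        "relabel \<alpha> \<tau>' = \<tau>'" "relabel \<beta> \<nu>' = \<nu>'" "y = young_embed m (\<alpha>, \<beta>)"
      by (auto simp: stabilizer_def sym_group_carrier)
    moreover have "y \<in> carrier (sym_group (m + k))"
      using young_embed_mon[of m k] ab by (auto simp: mon_def hom_def sym_group_carrier)
    ultimately show "y \<in> stabilizer (sym_group (m + k)) relabel \<sigma>'"
      using young_embed_fixes_iff[OF \<tau>' \<nu>' du' ab(1,2)] by (simp add: stabilizer_def)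
  qed
  have "orbit_character (m + k) \<sigma> \<pi> =
      perm_character relabel (orbit (sym_group (m + k)) relabel \<sigma>') \<pi>"
    by (simp add: orbit_character_def \<sigma>'_def orbit_relabel[OF h])
  also have "\<dots> = induced (sym_group (m + k)) ?K (young_embed m)
      (perm_character ?\<psi> (orbit ?K ?\<psi> (\<tau>', \<nu>'))) \<pi>"
    using group_action_relabel finite_sym_group actK young_embed_mon stab \<pi>
    by (intro perm_character_orbit_induced) auto
  \<comment> \<open>The orbit of a pair is the product of the orbits, so its character is the
    external product inside the induction product.\<close>
  also have "perm_character ?\<psi> (orbit ?K ?\<psi> (\<tau>', \<nu>')) =
      (\<lambda>(\<alpha>, \<beta>). orbit_character m \<tau>' \<alpha> * orbit_character k \<nu>' \<beta>)"
    by (auto simp: fun_eq_iff orbit_DirProd perm_character_map_prod orbit_character_def)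
  finally show "orbit_character (m + k) \<sigma> \<pi> =
      induction_product m k
        (orbit_character m (relabel f \<tau>)) (orbit_character k (relabel g \<nu>)) \<pi>"
    by (simp add: induction_product_def \<tau>'_def \<nu>'_def)
qed

end
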